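(* Let $G\le\operatorname{Aut}(T_X)$ be a perfect, self-similar subgroup that satisfies property H. For every non-empty $\Omega\subseteq\mathcal{S}$ and every word $v\in X^*$ of length $\ell$, the rigid stabilizer of $v$ in $\Gamma_G^{\Omega}$ is given by $\operatorname{RiSt}_{\Gamma_G^{\Omega}}(v)=\iota_v(\Gamma_G^{L^{\ell}(\Omega)})$. Moreover, $\operatorname{RiSt}_{\Gamma_G^{\Omega}}(\ell)=\operatorname{St}_{\Gamma_G^{\Omega}}(\ell)$ for every $\ell\in\mathbb{N}_0$. In particular, $\Gamma_G^{\Omega}$ is a branch group and its action on $T_X$ is level-transitive.
   Context: Let $X$ be a non-empty finite set with a fixed element $o\in X$ and $X^+=X\setminus\{o\}$. $X^*$ is the set of finite words over $X$; $T_X$ is the rooted tree with vertex set $X^*$, root the empty word, and edges joining $w$ to $wx$ ($w\in X^*$, $x\in X$); level $\ell$ is $X^\ell$. $\operatorname{Aut}(T_X)$ is the group of root-fixing graph automorphisms. For $\alpha\in\operatorname{Aut}(T_X)$, $\sigma_\alpha\in\operatorname{Sym}(X)$ is the induced permutation of level 1, and for $x\in X$ the state $\alpha_x\in\operatorname{Aut}(T_X)$ is defined by $\alpha(xw)=\sigma_\alpha(x)\alpha_x(w)$ for all $w\in X^*$. A subgroup $G\le\operatorname{Aut}(T_X)$ is self-similar if $g_x\in G$ for all $g\in G,x\in X$. It has property H if it acts transitively on $X$ and for all $x\ne y$ in $X$ there is $g\in G$ with $g(x)=x$ and $g(y)\ne y$. $\mathcal{S}$ is the set of infinite sequences $\omega=(\omega_k)_{k\ge1}$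 over $X^+$; $L(\omega_1,\omega_2,\dots)=(\omega_2,\omega_3,\dots)$ and $L^\ell(\Omega)=\{L^\ell(\omega)\mid\omega\in\Omega\}$. For $\alpha\in\operatorname{Aut}(T_X)$ and $\omega\in\mathcal{S}$, $\widetilde{\alpha}^{\omega}\in\operatorname{Aut}(T_X)$ fixes level 1 pointwise and is given recursively by its states: $\widetilde{\alpha}^{L(\omega)}$ at $o$, $\alpha$ at $\omega_1$, and $\operatorname{id}$ at every other $x\in X$. $\Gamma_G^{\Omega}$ is the subgroup of $\operatorname{Aut}(T_X)$ generated by $G$ and all $\widetilde{g}^{\omega}$ with $g\in G,\omega\in\Omega$. For $v\in X^*$ of length $\ell$ and $g\in\operatorname{Aut}(T_X)$, $\iota_v(g)\in\operatorname{Aut}(T_X)$ is given by $\iota_v(g)(vw)=vg(w)$ and $\iota_v(g)(uw)=uw$ for $u\in X^\ell\setminus\{v\}$, $w\in X^*$ (and $\iota_v(g)$ fixes all vertices of level at most $\ell$). For a subgroup $\Gamma\le\operatorname{Aut}(T_X)$: $\operatorname{St}_\Gamma(\ell)$ is the pointwise stabilizer of $X^\ell$; $\operatorname{RiSt}_\Gamma(v)$ is the subgroup of elements of $\Gamma$ fixing $v$ and every vertex outside $vX^*$; $\operatorname{RiSt}_\Gamma(\ell)$ is the subgroup generated by all $\operatorname{RiSt}_\Gamma(v)$, $v\in X^\ell$. $\Gamma$ is a branch group if $\operatorname{RiSt}_\Gamma(\ell)$ has finite index in $\Gamma$ for every $\ell\in\mathbb{N}$; it is level-transitive if it acts transitively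 on each $X^\ell$. *)

theory Defs
  imports "HOL-Algebra.Generated_Groups" "HOL-Library.Sublist"
begin

text \<open>
  The alphabet \<open>X\<close> is a type of class \<^class>\<open>finite\<close> (types are non-empty), and the vertex set
  of the tree is the type of words over it.
\<close>

definition tree_adj :: "'x list \<Rightarrow> 'x list \<Rightarrow> bool" where
  "tree_adj u w \<longleftrightarrow> (\<exists>x. w = u @ [x]) \<or> (\<exists>x. u = w @ [x])"

definition AutT :: "('x list \<Rightarrow> 'x list) monoid" where
  "AutT = \<lparr>carrier = {f. bij f \<and> f [] = [] \<and> (\<forall>u w. tree_adj (f u) (f w) \<longleftrightarrow> tree_adj u w)},
           mult = (\<circ>), one = id\<rparr>"

definition root_perm :: "('x list \<Rightarrow> 'x list) \<Rightarrow> 'x \<Rightarrow> 'x" where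
  "root_perm \<alpha> x = hd (\<alpha> [x])"

text \<open>
  Deleting the first letter of \<open>\<alpha> (x # w)\<close> yields the state of \<open>\<alpha>\<close> at \<open>x\<close>;
  the defining equation \<open>\<alpha>(xw) = \<sigma>(x) \<alpha>\<^sub>x(w)\<close> is lemma \<open>AutT_Cons\<close> below.
\<close>

definition state :: "('x list \<Rightarrow> 'x list) \<Rightarrow> 'x \<Rightarrow> 'x list \<Rightarrow> 'x list" where
  "state \<alpha> x w = tl (\<alpha> (x # w))"

definition self_similar :: "('x list \<Rightarrow> 'x list) set \<Rightarrow> bool" where
  "self_similar G \<longleftrightarrow> (\<forall>g\<in>G. \<forall>x. state g x \<in> G)"

definition property_H :: "('x list \<Rightarrow> 'x list) set \<Rightarrow> bool" where
  "property_H G \<longleftrightarrow>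
     (\<forall>x y. \<exists>g\<in>G. root_perm g x = y) \<and>
     (\<forall>x y. x \<noteq> y \<longrightarrow> (\<exists>g\<in>G. root_perm g x = x \<and> root_perm g y \<noteq> y))"

definition perfect :: "('x list \<Rightarrow> 'x list) set \<Rightarrow> bool" where
  "perfect G \<longleftrightarrow> derived AutT G = G"

text \<open>
  Sequences over \<open>X\<close> without the base letter \<open>x0\<close>, indexed from \<open>0\<close>:
  \<open>\<omega> k\<close> is the entry with index \<open>k + 1\<close> of a sequence that is numbered from \<open>1\<close>.
\<close>

definition seqs :: "'x \<Rightarrow> (nat \<Rightarrow> 'x) set" where
  "seqs x0 = {\<omega>. \<forall>k. \<omega> k \<noteq> x0}"

definition shift :: "(nat \<Rightarrow> 'x) \<Rightarrow> nat \<Rightarrow> 'x" where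
  "shift \<omega> k = \<omega> (Suc k)"

fun tilde :: "'x \<Rightarrow> ('x list \<Rightarrow> 'x list) \<Rightarrow> (nat \<Rightarrow> 'x) \<Rightarrow> 'x list \<Rightarrow> 'x list" where
  "tilde x0 \<alpha> \<omega> [] = []"
| "tilde x0 \<alpha> \<omega> (x # w) =
     x # (if x = x0 then tilde x0 \<alpha> (shift \<omega>) w else if x = \<omega> 0 then \<alpha> w else w)"

definition Gamma :: "'x \<Rightarrow> ('x list \<Rightarrow> 'x list) set \<Rightarrow> (nat \<Rightarrow> 'x) set \<Rightarrow> ('x list \<Rightarrow> 'x list) set" where
  "Gamma x0 G \<Omega> = generate AutT (G \<union> {tilde x0 g \<omega> | g \<omega>. g \<in> G \<and> \<omega> \<in> \<Omega>})"

definition iota :: "'x list \<Rightarrow> ('x list \<Rightarrow> 'x list) \<Rightarrow> 'x list \<Rightarrow> 'x list" where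
  "iota v g u = (if prefix v u then v @ g (drop (length v) u) else u)"

definition St :: "('x list \<Rightarrow> 'x list) set \<Rightarrow> nat \<Rightarrow> ('x list \<Rightarrow> 'x list) set" where
  "St \<Gamma> l = {g \<in> \<Gamma>. \<forall>v. length v = l \<longrightarrow> g v = v}"

definition RiSt :: "('x list \<Rightarrow> 'x list) set \<Rightarrow> 'x list \<Rightarrow> ('x list \<Rightarrow> 'x list) set" where
  "RiSt \<Gamma> v = {g \<in> \<Gamma>. g v = v \<and> (\<forall>u. \<not> prefix v u \<longrightarrow> g u = u)}"

definition RiSt_level :: "('x list \<Rightarrow> 'x list) set \<Rightarrow> nat \<Rightarrow> ('x list \<Rightarrow> 'x list) set" where
  "RiSt_level \<Gamma> l = generate AutT (\<Union>v\<in>{v. length v = l}. RiSt \<Gamma> v)"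

definition branch_group :: "('x list \<Rightarrow> 'x list) set \<Rightarrow> bool" where
  "branch_group \<Gamma> \<longleftrightarrow>
     subgroup \<Gamma> AutT \<and> (\<forall>l. finite (rcosets\<^bsub>AutT\<lparr>carrier := \<Gamma>\<rparr>\<^esub> (RiSt_level \<Gamma> l)))"

definition level_transitive :: "('x list \<Rightarrow> 'x list) set \<Rightarrow> bool" where
  "level_transitive \<Gamma> \<longleftrightarrow>
     (\<forall>l u v. length u = l \<and> length v = l \<longrightarrow> (\<exists>g\<in>\<Gamma>. g u = v))"


lemma group_AutT: "group (AutT :: ('x list \<Rightarrow> 'x list) monoid)"
proof (rule groupI)
  fix f :: "'x list \<Rightarrow> 'x list" assume "f \<in> carrier AutT"
  then have b: "bij f" and f0: "f [] = []"
    and a: "\<And>u w. tree_adj (f u) (f w) \<longleftrightarrow> tree_adj u w"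
    by (auto simp: AutT_def)
  have fi: "f (inv_into UNIV f u) = u" for u
    using b by (simp add: bij_is_surj surj_f_inv_f)
  have "inv_into UNIV f [] = []"
    by (metis b f0 bij_is_inj inv_f_f)
  moreover have "tree_adj (inv_into UNIV f u) (inv_into UNIV f w) \<longleftrightarrow> tree_adj u w" for u w
    using a[of "inv_into UNIV f u" "inv_into UNIV f w"] by (simp add: fi)
  ultimately have "inv_into UNIV f \<in> carrier AutT"
    using b by (simp add: AutT_def bij_imp_bij_inv)
  moreover have "inv_into UNIV f \<circ> f = id"
    using b by (simp add: bij_is_inj)
  ultimately show "\<exists>y\<in>carrier AutT. y \<otimes>\<^bsub>AutT\<^esub> f = \<one>\<^bsub>AutT\<^esub>"
    by (auto simp: AutT_def)
qed (auto simp: AutT_def bij_comp comp_assoc)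

lemma AutT_snoc:
  assumes "f \<in> carrier AutT"
  shows "\<exists>y. f (w @ [x]) = f w @ [y]"
proof (induction w arbitrary: x rule: rev_induct)
  case Nil
  have "tree_adj [] [x]" by (simp add: tree_adj_def)
  then have "tree_adj (f []) (f [x])" using assms unfolding AutT_def by simp metis
  moreover have "f [] = []" using assms by (simp add: AutT_def)
  ultimately show ?case by (auto simp: tree_adj_def)
next
  case (snoc z w)
  have inj: "inj f" using assms by (auto simp: AutT_def bij_is_inj)
  obtain y where y: "f (w @ [z]) = f w @ [y]" using snoc by blast
  have "tree_adj (w @ [z]) ((w @ [z]) @ [x])" by (simp add: tree_adj_def)
  then have "tree_adj (f (w @ [z])) (f ((w @ [z]) @ [x]))" using assms by (simp add: AutT_def)
  moreover have "f ((w @ [z]) @ [x]) \<noteq> f w"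
    using inj by (auto dest: injD)
  ultimately show ?case
    using y by (auto simp: tree_adj_def)
qed

lemma AutT_length:
  assumes "f \<in> carrier AutT"
  shows "length (f w) = length w"
proof (induction w rule: rev_induct)
  case Nil then show ?case using assms by (simp add: AutT_def)
next
  case (snoc x w)
  then show ?case using AutT_snoc[OF assms, of w x] by auto
qed

lemma AutT_append:
  assumes "f \<in> carrier AutT"
  shows "\<exists>w'. f (u @ w) = f u @ w'"
proof (induction w rule: rev_induct)
  case Nil then show ?case by simp
next
  case (snoc x w)
  then show ?case using AutT_snoc[OF assms, of "u @ w" x] by auto
qed

lemma AutT_Cons:
  assumes "\<alpha> \<in> carrier AutT"
  shows "\<alpha> (x # w) = root_perm \<alpha> x # state \<alpha> x w"
proof -
  obtain w' where w': "\<alpha> (x # w) = \<alpha> [x] @ w'" using AutT_append[OF assms, of "[x]" w] by auto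
  have "length (\<alpha> [x]) = 1" using AutT_length[OF assms, of "[x]"] by simp
  then obtain y where "\<alpha> [x] = [y]" by (metis One_nat_def length_0_conv length_Suc_conv)
  then show ?thesis using w' by (simp add: root_perm_def state_def)
qed

lemma AutT_I:
  assumes b: "bij f" and f0: "f [] = []" and s: "\<And>u x. \<exists>y. f (u @ [x]) = f u @ [y]"
  shows "f \<in> carrier AutT"
proof -
  have parent: "w = u" if "f v = f u @ [y]" "v = w @ [x]" for u v w x y
  proof -
    have "f w = f u" using s[of w x] that by auto
    then show ?thesis using b by (auto dest: bij_is_inj injD)
  qed
  have child: "\<exists>x. v = u @ [x]" if "f v = f u @ [y]" for u v y
  proof (cases v rule: rev_cases)
    case Nil then show ?thesis using that f0 by simp
  next
    case (snoc w x) then show ?thesis using parent[OF that] by auto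
  qed
  have "tree_adj (f u) (f w) \<longleftrightarrow> tree_adj u w" for u w
    unfolding tree_adj_def using s child by metis
  then show ?thesis using b f0 by (simp add: AutT_def)
qed

lemma state_in_AutT:
  assumes a: "\<alpha> \<in> carrier AutT"
  shows "state \<alpha> x \<in> carrier AutT"
proof (rule AutT_I)
  have b: "bij \<alpha>" using a by (simp add: AutT_def)
  have "inj (state \<alpha> x)"
  proof (rule injI)
    fix u w assume "state \<alpha> x u = state \<alpha> x w"
    then have "\<alpha> (x # u) = \<alpha> (x # w)" by (simp add: AutT_Cons[OF a])
    then show "u = w" using b by (auto dest: bij_is_inj injD)
  qed
  moreover have "\<exists>u. w = state \<alpha> x u" for w
  proof -
    obtain v where v: "\<alpha> v = root_perm \<alpha> x # w" using b by (metis bij_pointE)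
    then obtain y u where yu: "v = y # u" using AutT_length[OF a, of v] by (cases v) auto
    have e: "root_perm \<alpha> y = root_perm \<alpha> x" "state \<alpha> y u = w"
      using v yu AutT_Cons[OF a, of y u] by auto
    have "state \<alpha> z [] = []" for z
      using AutT_length[OF a, of "[z]"] by (cases "\<alpha> [z]") (auto simp: state_def)
    then have "\<alpha> [y] = \<alpha> [x]" using e by (simp add: AutT_Cons[OF a])
    then have "y = x" using b by (auto dest: bij_is_inj injD)
    then show ?thesis using e by auto
  qed
  ultimately show "bij (state \<alpha> x)" by (auto simp: bij_def surj_def)
  show "state \<alpha> x [] = []" using AutT_length[OF a, of "[x]"] by (cases "\<alpha> [x]") (auto simp: state_def)
  show "\<exists>y. state \<alpha> x (u @ [z]) = state \<alpha> x u @ [y]" for u z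
    using AutT_snoc[OF a, of "x # u" z] by (simp add: AutT_Cons[OF a])
qed

lemma tilde_inverse:
  assumes "\<And>w. \<beta> (\<alpha> w) = w"
  shows "tilde x0 \<beta> \<omega> (tilde x0 \<alpha> \<omega> w) = w"
  by (induction w arbitrary: \<omega>) (auto simp: assms)

lemma tilde_in_AutT:
  assumes a: "\<alpha> \<in> carrier AutT"
  shows "tilde x0 \<alpha> \<omega> \<in> carrier AutT"
proof (rule AutT_I)
  have b: "bij \<alpha>" using a by (simp add: AutT_def)
  have "tilde x0 (inv_into UNIV \<alpha>) \<omega> (tilde x0 \<alpha> \<omega> w) = w" for w
    using b by (intro tilde_inverse) (simp add: bij_is_inj)
  moreover have "tilde x0 \<alpha> \<omega> (tilde x0 (inv_into UNIV \<alpha>) \<omega> w) = w" for w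
    using b by (intro tilde_inverse) (simp add: bij_is_surj surj_f_inv_f)
  ultimately show "bij (tilde x0 \<alpha> \<omega>)"
    by (intro o_bij[where g = "tilde x0 (inv_into UNIV \<alpha>) \<omega>"]) (auto simp: fun_eq_iff)
  show "\<exists>y. tilde x0 \<alpha> \<omega> (u @ [x]) = tilde x0 \<alpha> \<omega> u @ [y]" for u x
  proof (induction u arbitrary: \<omega>)
    case Nil
    have "\<alpha> [] = []" using a by (simp add: AutT_def)
    then show ?case by simp
  next
    case (Cons z u)
    then show ?case using AutT_snoc[OF a, of u x] by auto
  qed
qed simp

lemma iota_inverse:
  assumes "\<And>w. h (g w) = w"
  shows "iota v h (iota v g u) = u"
  by (auto simp: iota_def assms prefix_def)

lemma iota_in_AutT:
  assumes a: "g \<in> carrier AutT"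
  shows "iota v g \<in> carrier AutT"
proof (rule AutT_I)
  have b: "bij g" and g0: "g [] = []" using a by (simp_all add: AutT_def)
  have "iota v (inv_into UNIV g) (iota v g w) = w" for w
    using b by (intro iota_inverse) (simp add: bij_is_inj)
  moreover have "iota v g (iota v (inv_into UNIV g) w) = w" for w
    using b by (intro iota_inverse) (simp add: bij_is_surj surj_f_inv_f)
  ultimately show "bij (iota v g)"
    by (intro o_bij[where g = "iota v (inv_into UNIV g)"]) (auto simp: fun_eq_iff)
  show "iota v g [] = []" using g0 by (auto simp: iota_def)
  show "\<exists>y. iota v g (u @ [x]) = iota v g u @ [y]" for u x
  proof (cases "prefix v u")
    case True
    then obtain w where "u = v @ w" by (auto simp: prefix_def)
    then show ?thesis using AutT_snoc[OF a, of w x] by (auto simp: iota_def)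
  next
    case False
    then show ?thesis using g0 by (auto simp: iota_def)
  qed
qed

end

theory Submission
  imports Defs
begin

text \<open>
  Everything rests on the inclusion of \<open>iota [x] ` Gamma x0 G (shift ` \<Omega>)\<close> in \<open>Gamma x0 G \<Omega>\<close> for
  each letter \<open>x\<close>: every automorphism that can possibly be the state at \<open>x\<close> of an element also occurs
  alone, with trivial states at the other letters. Commutators produce this
  (\<open>iota_G_first_letter\<close>). For \<open>\<omega> \<in> \<Omega>\<close> and \<open>a, b \<in> G\<close>, the element \<open>tilde x0 a \<omega>\<close> can act
  non-trivially only below \<open>x0\<close> and \<open>\<omega> 0\<close>. Property H gives \<open>k \<in> G\<close> that fixes the letter \<open>\<omega> 0\<close>
  and moves \<open>x0\<close>; the \<open>k\<close>-conjugate of \<open>tilde x0 b \<omega>\<close> then acts only below the image of \<open>x0\<close> and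
  below \<open>\<omega> 0\<close>. The commutator of the two therefore acts only below \<open>\<omega> 0\<close>, by the commutator of \<open>a\<close>
  with a conjugate of \<open>b\<close> in \<open>G\<close>. As \<open>G\<close> is perfect, a copy of \<open>G\<close> below \<open>\<omega> 0\<close> is obtained;
  dividing \<open>tilde x0 g \<omega>\<close> by its state there leaves \<open>tilde x0 g (shift \<omega>)\<close> below \<open>x0\<close>; and
  transitivity of \<open>G\<close> on letters carries both to every vertex of the first level
  (\<open>iota_single_Gamma\<close>). Iterating along a word gives the inclusion at every vertex
  (\<open>iota_Gamma\<close>).

  Conversely, the states of the generators of \<open>Gamma x0 G \<Omega>\<close> lie in \<open>Gamma x0 G (shift ` \<Omega>)\<close>, hence
  so do the states of all elements (\<open>state_Gamma\<close>, \<open>section_at_Gamma\<close>). An element of a rigid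
  stabilizer is its section embedded at the vertex, which identifies the rigid stabilizers
  (\<open>RiSt_Gamma\<close>). For the same reason an element that fixes a level pointwise is a product of rigid
  elements of the group, one for each vertex of that level (\<open>RiSt_level_eq_St\<close>). Level stabilizers
  have finite index since the levels are finite, and level transitivity follows by correcting one
  letter at a time.
\<close>

section \<open>Computing in the automorphism group\<close>

interpretation AutT: group "AutT :: ('x list \<Rightarrow> 'x list) monoid"
  by (rule group_AutT)

lemma AutT_mult [simp]: "f \<otimes>\<^bsub>AutT\<^esub> g = f \<circ> g"
  and AutT_one [simp]: "\<one>\<^bsub>AutT\<^esub> = id"
  by (simp_all add: AutT_def)

lemma id_in_AutT: "id \<in> carrier AutT"
  using AutT.one_closed by simp

lemma comp_in_AutT: "f \<in> carrier AutT \<Longrightarrow> g \<in> carrier AutT \<Longrightarrow> f \<circ> g \<in> carrier AutT"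
  using AutT.m_closed[of f g] by simp

lemma AutT_Nil: "f \<in> carrier AutT \<Longrightarrow> f [] = []"
  by (simp add: AutT_def)

lemma AutT_inv_left: "f \<in> carrier AutT \<Longrightarrow> inv\<^bsub>AutT\<^esub> f \<circ> f = id"
  and AutT_inv_right: "f \<in> carrier AutT \<Longrightarrow> f \<circ> inv\<^bsub>AutT\<^esub> f = id"
  using AutT.l_inv[of f] AutT.r_inv[of f] by simp_all

lemma AutT_inv_apply:
  assumes "f \<in> carrier AutT"
  shows "(inv\<^bsub>AutT\<^esub> f) (f w) = w" and "f ((inv\<^bsub>AutT\<^esub> f) w) = w"
  using AutT_inv_left[OF assms] AutT_inv_right[OF assms] by (metis comp_apply id_apply)+

lemma AutT_inv_eqI:
  assumes "f \<in> carrier AutT" "g \<in> carrier AutT" "f \<circ> g = id"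
  shows "inv\<^bsub>AutT\<^esub> f = g"
  using AutT.inv_equality[of f g] AutT.inv_inv[of g] assms by simp

section \<open>States of compositions and inverses\<close>

lemma root_perm_comp:
  assumes "f \<in> carrier AutT" "g \<in> carrier AutT"
  shows "root_perm (f \<circ> g) x = root_perm f (root_perm g x)"
  using assms by (simp add: root_perm_def[of "f \<circ> g"] AutT_Cons)

lemma root_perm_id [simp]: "root_perm id x = x"
  by (simp add: root_perm_def)

lemma state_comp:
  assumes "f \<in> carrier AutT" "g \<in> carrier AutT"
  shows "state (f \<circ> g) x = state f (root_perm g x) \<circ> state g x"
  using assms by (simp add: fun_eq_iff state_def[of "f \<circ> g"] AutT_Cons)

lemma state_id [simp]: "state id x = id"
  by (simp add: state_def fun_eq_iff)

lemma root_perm_inv: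
  assumes "f \<in> carrier AutT"
  shows "root_perm (inv\<^bsub>AutT\<^esub> f) (root_perm f x) = x"
    and "root_perm f (root_perm (inv\<^bsub>AutT\<^esub> f) x) = x"
  using root_perm_comp[of f "inv\<^bsub>AutT\<^esub> f" x] root_perm_comp[of "inv\<^bsub>AutT\<^esub> f" f x] assms
  by (simp_all add: AutT_inv_left AutT_inv_right)

lemma state_inv:
  assumes f: "f \<in> carrier AutT"
  shows "state (inv\<^bsub>AutT\<^esub> f) x = inv\<^bsub>AutT\<^esub> (state f (root_perm (inv\<^bsub>AutT\<^esub> f) x))"
proof -
  have "state f (root_perm (inv\<^bsub>AutT\<^esub> f) x) \<circ> state (inv\<^bsub>AutT\<^esub> f) x = id"
    using state_comp[of f "inv\<^bsub>AutT\<^esub> f" x] f by (simp add: AutT_inv_right)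
  then show ?thesis
    using f by (intro AutT_inv_eqI[symmetric] state_in_AutT AutT.inv_closed)
qed

section \<open>Automorphisms that fix the first level\<close>

text \<open>
  The image of a family of automorphisms under the isomorphism from the direct power of the
  automorphism group, indexed by the letters, to the stabilizer of the first level. Working with
  families turns products, inverses and commutators into letterwise computations.
\<close>
definition level1_prod :: "('x \<Rightarrow> 'x list \<Rightarrow> 'x list) \<Rightarrow> 'x list \<Rightarrow> 'x list" where
  "level1_prod f u = (case u of [] \<Rightarrow> [] | x # w \<Rightarrow> x # f x w)"

lemma level1_prod_simps [simp]:
  "level1_prod f [] = []" "level1_prod f (x # w) = x # f x w"
  by (simp_all add: level1_prod_def)

lemma level1_prod_eqI:
  assumes "g [] = []" "\<And>x w. g (x # w) = x # f x w"
  shows "g = level1_prod f"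
proof
  fix u show "g u = level1_prod f u" using assms by (cases u) auto
qed

lemma level1_prod_comp: "level1_prod f \<circ> level1_prod g = level1_prod (\<lambda>x. f x \<circ> g x)"
  by (rule level1_prod_eqI) auto

lemma level1_prod_id: "level1_prod (\<lambda>x. id) = id"
  by (rule level1_prod_eqI[symmetric]) auto

lemma level1_prod_in_AutT:
  assumes f: "\<And>x. f x \<in> carrier AutT"
  shows "level1_prod f \<in> carrier AutT"
proof (rule AutT_I)
  show "bij (level1_prod f)"
    by (rule o_bij[where g = "level1_prod (\<lambda>x. inv\<^bsub>AutT\<^esub> (f x))"])
      (simp_all add: level1_prod_comp AutT_inv_left AutT_inv_right f level1_prod_id)
  show "\<exists>y. level1_prod f (u @ [x]) = level1_prod f u @ [y]" for u x
    using AutT_Nil[OF f] AutT_snoc[OF f] by (cases u) auto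
qed simp

lemma level1_prod_inv:
  assumes "\<And>x. f x \<in> carrier AutT"
  shows "inv\<^bsub>AutT\<^esub> (level1_prod f) = level1_prod (\<lambda>x. inv\<^bsub>AutT\<^esub> (f x))"
  using assms by (intro AutT_inv_eqI)
    (simp_all add: level1_prod_in_AutT level1_prod_comp AutT_inv_right level1_prod_id)

lemma iota_single: "iota [x] g = level1_prod (\<lambda>y. if y = x then g else id)"
  by (rule level1_prod_eqI) (auto simp: iota_def)

lemma tilde_level1_prod:
  "tilde x0 g \<omega> =
     level1_prod (\<lambda>x. if x = x0 then tilde x0 g (shift \<omega>) else if x = \<omega> 0 then g else id)"
  by (rule level1_prod_eqI) auto

text \<open>
  Conjugation permutes the states of an element of the first level stabilizer and conjugates each
  of them: this is how one non-trivial state is carried to another position of the first level.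
\<close>
lemma level1_prod_conj:
  assumes k: "k \<in> carrier AutT"
  shows "k \<circ> level1_prod f \<circ> inv\<^bsub>AutT\<^esub> k =
    level1_prod (\<lambda>x. state k (root_perm (inv\<^bsub>AutT\<^esub> k) x) \<circ> f (root_perm (inv\<^bsub>AutT\<^esub> k) x)
                     \<circ> inv\<^bsub>AutT\<^esub> (state k (root_perm (inv\<^bsub>AutT\<^esub> k) x)))"
  using k by (intro level1_prod_eqI)
    (simp_all add: AutT_Nil AutT_Cons root_perm_inv state_inv[symmetric])

lemma iota_conj:
  assumes k: "k \<in> carrier AutT"
  shows "k \<circ> iota [x] g \<circ> inv\<^bsub>AutT\<^esub> k =
    iota [root_perm k x] (state k x \<circ> g \<circ> inv\<^bsub>AutT\<^esub> (state k x))"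
proof -
  let ?p = "root_perm (inv\<^bsub>AutT\<^esub> k)"
  have "state k (?p y) \<circ> (if ?p y = x then g else id) \<circ> inv\<^bsub>AutT\<^esub> (state k (?p y)) =
      (if y = root_perm k x then state k x \<circ> g \<circ> inv\<^bsub>AutT\<^esub> (state k x) else id)" for y
  proof (cases "y = root_perm k x")
    case True
    then have "?p y = x" by (simp add: root_perm_inv(1)[OF k])
    then show ?thesis using True by simp
  next
    case False
    then have "?p y \<noteq> x" using root_perm_inv(2)[OF k, of y] by auto
    then show ?thesis using False by (simp add: AutT_inv_right state_in_AutT[OF k])
  qed
  then show ?thesis
    unfolding iota_single level1_prod_conj[OF k]
    by (intro arg_cong[of _ _ level1_prod]) (rule ext)
qed

text \<open>
  At every first-level position other than \<open>z\<close> one of the two elements acts trivially, so that the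
  commutator has a trivial state there.
\<close>
lemma level1_prod_commutator:
  assumes f: "\<And>x. f x \<in> carrier AutT" and g: "\<And>x. g x \<in> carrier AutT"
    and disj: "\<And>x. x \<noteq> z \<Longrightarrow> f x = id \<or> g x = id"
  shows "level1_prod f \<circ> level1_prod g \<circ> inv\<^bsub>AutT\<^esub> (level1_prod f) \<circ> inv\<^bsub>AutT\<^esub> (level1_prod g) =
    iota [z] (f z \<circ> g z \<circ> inv\<^bsub>AutT\<^esub> (f z) \<circ> inv\<^bsub>AutT\<^esub> (g z))"
proof -
  have inv_id: "inv\<^bsub>AutT\<^esub> id = (id :: 'a list \<Rightarrow> 'a list)"
    using AutT.inv_one by simp
  have "f x \<circ> g x \<circ> inv\<^bsub>AutT\<^esub> (f x) \<circ> inv\<^bsub>AutT\<^esub> (g x) = id" if "x \<noteq> z" for x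
    using disj[OF that] AutT_inv_right[OF f, of x] AutT_inv_right[OF g, of x] by (auto simp: inv_id)
  then have "(\<lambda>x. f x \<circ> g x \<circ> inv\<^bsub>AutT\<^esub> (f x) \<circ> inv\<^bsub>AutT\<^esub> (g x)) =
      (\<lambda>x. if x = z then f z \<circ> g z \<circ> inv\<^bsub>AutT\<^esub> (f z) \<circ> inv\<^bsub>AutT\<^esub> (g z) else id)"
    by (auto simp del: o_apply)
  then show ?thesis
    unfolding level1_prod_inv[of f, OF f] level1_prod_inv[of g, OF g] level1_prod_comp iota_single
    by (rule arg_cong)
qed

section \<open>Embedding automorphisms below a vertex\<close>

lemma iota_hom: "iota v \<in> hom AutT AutT"
proof (rule homI)
  show "iota v (f \<otimes>\<^bsub>AutT\<^esub> g) = iota v f \<otimes>\<^bsub>AutT\<^esub> iota v g" for f g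
    by (auto simp: fun_eq_iff iota_def prefix_def)
qed (rule iota_in_AutT)

lemma iota_Cons: "iota (x # v) g = iota [x] (iota v g)"
  by (auto simp: fun_eq_iff iota_def prefix_def)

lemma iota_Nil: "iota [] g = g"
  by (auto simp: fun_eq_iff iota_def)

text \<open>
  Embedding below a vertex is a homomorphism, so the embedded copy of a generated group may be
  checked on generators.
\<close>
lemma iota_generate_subset:
  assumes S: "S \<subseteq> carrier AutT" and H: "subgroup H AutT" and im: "iota v ` S \<subseteq> H"
  shows "iota v ` generate AutT S \<subseteq> H"
proof -
  interpret group_hom AutT AutT "iota v"
    by unfold_locales (rule iota_hom)
  show ?thesis
    using generate_img[OF S] AutT.generate_subgroup_incl[OF im H] by simp
qed

section \<open>The groups generated by a self-similar group and its spinal elements\<close>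

locale perfect_self_similar =
  fixes x0 :: "'x::finite" and G :: "('x list \<Rightarrow> 'x list) set"
  assumes G_subgroup: "subgroup G AutT" and G_perfect: "perfect G"
    and G_self_similar: "self_similar G" and G_property_H: "property_H G"
begin

lemma G_AutT: "g \<in> G \<Longrightarrow> g \<in> carrier AutT"
  using subgroup.mem_carrier[OF G_subgroup] .

lemma G_comp: "a \<in> G \<Longrightarrow> b \<in> G \<Longrightarrow> a \<circ> b \<in> G"
  using subgroup.m_closed[OF G_subgroup, of a b] by simp

lemma G_inv: "a \<in> G \<Longrightarrow> inv\<^bsub>AutT\<^esub> a \<in> G"
  using subgroup.m_inv_closed[OF G_subgroup] .

lemma state_G: "g \<in> G \<Longrightarrow> state g x \<in> G"
  using G_self_similar by (auto simp: self_similar_def)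

lemma Gamma_generators_AutT:
  "G \<union> {tilde x0 g \<omega> | g \<omega>. g \<in> G \<and> \<omega> \<in> \<Omega>} \<subseteq> carrier AutT"
  by (auto intro: G_AutT tilde_in_AutT)

lemma Gamma_subgroup: "subgroup (Gamma x0 G \<Omega>) AutT"
  unfolding Gamma_def by (rule AutT.generate_is_subgroup[OF Gamma_generators_AutT])

lemma Gamma_AutT: "\<gamma> \<in> Gamma x0 G \<Omega> \<Longrightarrow> \<gamma> \<in> carrier AutT"
  using subgroup.mem_carrier[OF Gamma_subgroup] .

lemma Gamma_comp: "a \<in> Gamma x0 G \<Omega> \<Longrightarrow> b \<in> Gamma x0 G \<Omega> \<Longrightarrow> a \<circ> b \<in> Gamma x0 G \<Omega>"
  using subgroup.m_closed[OF Gamma_subgroup, of a \<Omega> b] by simp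

lemma Gamma_inv: "a \<in> Gamma x0 G \<Omega> \<Longrightarrow> inv\<^bsub>AutT\<^esub> a \<in> Gamma x0 G \<Omega>"
  using subgroup.m_inv_closed[OF Gamma_subgroup] .

lemma Gamma_id: "id \<in> Gamma x0 G \<Omega>"
  using subgroup.one_closed[OF Gamma_subgroup] by simp

lemma G_Gamma: "g \<in> G \<Longrightarrow> g \<in> Gamma x0 G \<Omega>"
  unfolding Gamma_def by (auto intro: generate.incl)

lemma tilde_Gamma: "g \<in> G \<Longrightarrow> \<omega> \<in> \<Omega> \<Longrightarrow> tilde x0 g \<omega> \<in> Gamma x0 G \<Omega>"
  unfolding Gamma_def by (auto intro: generate.incl)

text \<open>
  Each state of a generator is in \<open>G\<close>, or is the generator attached to a shifted
  sequence; the states of products and inverses are products and inverses of states.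
\<close>
lemma state_Gamma:
  assumes "\<gamma> \<in> Gamma x0 G \<Omega>"
  shows "state \<gamma> x \<in> Gamma x0 G (shift ` \<Omega>)"
proof -
  let ?S = "G \<union> {tilde x0 g \<omega> | g \<omega>. g \<in> G \<and> \<omega> \<in> \<Omega>}"
  have gen: "state h x \<in> Gamma x0 G (shift ` \<Omega>)" if h_gen: "h \<in> ?S" for h x
  proof (cases "h \<in> G")
    case True
    then show ?thesis by (intro G_Gamma state_G)
  next
    case False
    then obtain g \<omega> where h: "h = tilde x0 g \<omega>" and g: "g \<in> G" and \<omega>: "\<omega> \<in> \<Omega>"
      using h_gen by auto
    have "state h x = (if x = x0 then tilde x0 g (shift \<omega>) else if x = \<omega> 0 then g else id)"
      by (auto simp: h state_def fun_eq_iff)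
    then show ?thesis using g \<omega> by (simp add: tilde_Gamma G_Gamma Gamma_id)
  qed
  have "\<gamma> \<in> generate AutT ?S" using assms by (simp add: Gamma_def)
  then show ?thesis
  proof (induction arbitrary: x rule: generate.induct)
    case one
    show ?case unfolding AutT_one state_id by (rule Gamma_id)
  next
    case (incl h)
    then show ?case by (rule gen)
  next
    case (inv h)
    moreover have "h \<in> carrier AutT" using inv Gamma_generators_AutT by blast
    ultimately show ?case by (simp add: state_inv Gamma_inv gen)
  next
    case (eng h1 h2)
    have "h1 \<in> carrier AutT" "h2 \<in> carrier AutT"
      using eng.hyps AutT.generate_in_carrier[OF Gamma_generators_AutT] by blast+
    then show ?case
      unfolding AutT_mult by (simp only: state_comp) (intro Gamma_comp eng.IH)
  qed
qed

text \<open>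
  Property H supplies \<open>k \<in> G\<close> fixing the letter \<open>\<omega> 0\<close> and moving the base letter. The element
  \<open>tilde x0 a \<omega>\<close> and the \<open>k\<close>-conjugate of \<open>tilde x0 b \<omega>\<close> then share only the position \<open>\<omega> 0\<close>, so
  that their commutator is a commutator of \<open>G\<close> placed below \<open>\<omega> 0\<close>. Self-similarity puts the state
  of \<open>k\<close> at \<open>\<omega> 0\<close> into \<open>G\<close>, whence every commutator of \<open>G\<close> arises in this way, and since \<open>G\<close> is
  perfect these generate a full copy of \<open>G\<close>.
\<close>
lemma iota_G_first_letter:
  assumes \<omega>: "\<omega> \<in> \<Omega>" "\<omega> \<in> seqs x0" and g: "g \<in> G"
  shows "iota [\<omega> 0] g \<in> Gamma x0 G \<Omega>"
proof -
  have ne: "\<omega> 0 \<noteq> x0" using \<omega> by (simp add: seqs_def)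
  then obtain k where k: "k \<in> G" and fixk: "root_perm k (\<omega> 0) = \<omega> 0" and mv: "root_perm k x0 \<noteq> x0"
    using G_property_H unfolding property_H_def by blast
  have kA: "k \<in> carrier AutT" using k by (rule G_AutT)
  let ?p = "root_perm (inv\<^bsub>AutT\<^esub> k)" and ?s = "state k (\<omega> 0)"
  have s: "?s \<in> G" by (rule state_G[OF k])
  have p\<omega>: "?p x = \<omega> 0 \<longleftrightarrow> x = \<omega> 0" for x using root_perm_inv[OF kA] fixk by metis
  have px0: "?p x0 \<noteq> x0" using root_perm_inv(2)[OF kA, of x0] mv by metis
  have comm: "iota [\<omega> 0] (a \<circ> c \<circ> inv\<^bsub>AutT\<^esub> a \<circ> inv\<^bsub>AutT\<^esub> c) \<in> Gamma x0 G \<Omega>"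
    if a: "a \<in> G" and c: "c \<in> G" for a c
  proof -
    \<comment> \<open>chosen such that conjugation by the state of \<open>k\<close> at \<open>\<omega> 0\<close> turns \<open>b\<close> into \<open>c\<close>\<close>
    define b where "b = inv\<^bsub>AutT\<^esub> ?s \<circ> c \<circ> ?s"
    have b: "b \<in> G" unfolding b_def by (intro G_comp G_inv c s)
    have bc: "?s \<circ> b \<circ> inv\<^bsub>AutT\<^esub> ?s = c"
      using G_AutT[OF s] by (simp add: b_def fun_eq_iff AutT_inv_apply)
    define f where "f = (\<lambda>x. if x = x0 then tilde x0 a (shift \<omega>) else if x = \<omega> 0 then a else id)"
    define f' where "f' = (\<lambda>x. if x = x0 then tilde x0 b (shift \<omega>) else if x = \<omega> 0 then b else id)"
    define h where "h = (\<lambda>x. state k (?p x) \<circ> f' (?p x) \<circ> inv\<^bsub>AutT\<^esub> (state k (?p x)))"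
    have ta: "tilde x0 a \<omega> = level1_prod f" and tb: "tilde x0 b \<omega> = level1_prod f'"
      unfolding f_def f'_def by (rule tilde_level1_prod)+
    have hk: "k \<circ> tilde x0 b \<omega> \<circ> inv\<^bsub>AutT\<^esub> k = level1_prod h"
      unfolding tb h_def by (rule level1_prod_conj[OF kA])
    have fA: "f x \<in> carrier AutT" and f'A: "f' x \<in> carrier AutT" for x
      using a b by (auto simp: f_def f'_def tilde_in_AutT G_AutT id_in_AutT)
    have hA: "h x \<in> carrier AutT" for x
      unfolding h_def by (intro comp_in_AutT AutT.inv_closed state_in_AutT kA f'A)
    have "f x = id \<or> h x = id" if "x \<noteq> \<omega> 0" for x
      using that px0 p\<omega>[of x] by (auto simp: f_def h_def f'_def AutT_inv_right state_in_AutT kA)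
    then have "level1_prod f \<circ> level1_prod h \<circ> inv\<^bsub>AutT\<^esub> (level1_prod f) \<circ> inv\<^bsub>AutT\<^esub> (level1_prod h)
        = iota [\<omega> 0] (f (\<omega> 0) \<circ> h (\<omega> 0) \<circ> inv\<^bsub>AutT\<^esub> (f (\<omega> 0)) \<circ> inv\<^bsub>AutT\<^esub> (h (\<omega> 0)))"
      by (intro level1_prod_commutator fA hA)
    moreover have "f (\<omega> 0) = a" using ne by (simp add: f_def)
    moreover have "?p (\<omega> 0) = \<omega> 0" by (simp add: p\<omega>)
    then have "h (\<omega> 0) = c" using ne bc by (simp add: h_def f'_def)
    moreover have "level1_prod f \<in> Gamma x0 G \<Omega>" "level1_prod h \<in> Gamma x0 G \<Omega>"
      unfolding ta[symmetric] hk[symmetric]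
      by (intro Gamma_comp Gamma_inv G_Gamma tilde_Gamma k a b \<omega>)+
    ultimately show ?thesis by (metis Gamma_comp Gamma_inv)
  qed
  have "derived_set AutT G \<subseteq> carrier AutT"
    using AutT.derived_set_in_carrier[of G] G_AutT by blast
  moreover have "iota [\<omega> 0] ` derived_set AutT G \<subseteq> Gamma x0 G \<Omega>"
    using comm by auto
  ultimately have "iota [\<omega> 0] ` generate AutT (derived_set AutT G) \<subseteq> Gamma x0 G \<Omega>"
    by (intro iota_generate_subset Gamma_subgroup)
  moreover have "generate AutT (derived_set AutT G) = G"
    using G_perfect by (simp add: perfect_def derived_def)
  ultimately show ?thesis using g by auto
qed

text \<open>
  Conjugation by an element of \<open>G\<close> moves an embedded automorphism from \<open>x\<close> to the image of \<open>x\<close>,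
  at the price of conjugating it by the state at \<open>x\<close>. The premise compensates for this in advance;
  its twisted element stays in any group that contains \<open>G\<close> and \<open>g\<close>.
\<close>
lemma iota_conj_Gamma:
  assumes k: "k \<in> G" and i: "iota [x] (inv\<^bsub>AutT\<^esub> (state k x) \<circ> g \<circ> state k x) \<in> Gamma x0 G \<Omega>"
  shows "iota [root_perm k x] g \<in> Gamma x0 G \<Omega>"
proof -
  have kA: "k \<in> carrier AutT" using k by (rule G_AutT)
  have "iota [root_perm k x] g = k \<circ> iota [x] (inv\<^bsub>AutT\<^esub> (state k x) \<circ> g \<circ> state k x) \<circ> inv\<^bsub>AutT\<^esub> k"
    unfolding iota_conj[OF kA] using state_in_AutT[OF kA, of x]
    by (intro arg_cong[of _ _ "iota _"]) (simp add: fun_eq_iff AutT_inv_apply)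
  also have "\<dots> \<in> Gamma x0 G \<Omega>"
    by (intro Gamma_comp Gamma_inv G_Gamma k i)
  finally show ?thesis .
qed

lemma transitive_G: "\<exists>k\<in>G. root_perm k x = y"
  using G_property_H unfolding property_H_def by blast

text \<open>
  Transitivity carries the copy of \<open>G\<close> from the letter \<open>\<omega> 0\<close> of any chosen \<open>\<omega> \<in> \<Omega>\<close> to every
  letter, in particular to the base letter, below which the generators of the group for
  \<open>shift ` \<Omega>\<close> are collected first.
\<close>
lemma iota_G:
  assumes \<Omega>: "\<Omega> \<subseteq> seqs x0" "\<Omega> \<noteq> {}" and g: "g \<in> G"
  shows "iota [x] g \<in> Gamma x0 G \<Omega>"
proof -
  obtain \<omega> where \<omega>: "\<omega> \<in> \<Omega>" using \<Omega> by blast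
  obtain k where k: "k \<in> G" and kx: "root_perm k (\<omega> 0) = x" using transitive_G by blast
  have s: "state k (\<omega> 0) \<in> G" by (rule state_G[OF k])
  then have "inv\<^bsub>AutT\<^esub> (state k (\<omega> 0)) \<circ> g \<circ> state k (\<omega> 0) \<in> G"
    using g by (intro G_comp G_inv)
  then have "iota [\<omega> 0] (inv\<^bsub>AutT\<^esub> (state k (\<omega> 0)) \<circ> g \<circ> state k (\<omega> 0)) \<in> Gamma x0 G \<Omega>"
    using \<omega> \<Omega>(1) by (intro iota_G_first_letter) blast+
  then show ?thesis unfolding kx[symmetric] by (rule iota_conj_Gamma[OF k])
qed

text \<open>
  Since \<open>G\<close> can be placed below \<open>\<omega> 0\<close>, the state of \<open>tilde x0 g \<omega>\<close> there can be divided out,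
  which isolates its state at the base letter.
\<close>
lemma iota_tilde_base:
  assumes \<Omega>: "\<Omega> \<subseteq> seqs x0" and \<omega>: "\<omega> \<in> \<Omega>" and g: "g \<in> G"
  shows "iota [x0] (tilde x0 g (shift \<omega>)) \<in> Gamma x0 G \<Omega>"
proof -
  have ne: "\<omega> 0 \<noteq> x0" using \<omega> \<Omega> by (auto simp: seqs_def)
  have gi: "inv\<^bsub>AutT\<^esub> g \<in> G" by (rule G_inv[OF g])
  have "tilde x0 g \<omega> \<circ> iota [\<omega> 0] (inv\<^bsub>AutT\<^esub> g) = iota [x0] (tilde x0 g (shift \<omega>))"
    unfolding tilde_level1_prod[of x0 g \<omega>] iota_single level1_prod_comp
    using ne G_AutT[OF g] by (intro arg_cong[of _ _ level1_prod]) (auto simp: AutT_inv_right)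
  then show ?thesis
    using Gamma_comp[OF tilde_Gamma[OF g \<omega>] iota_G_first_letter[OF \<omega> _ gi]] \<omega> \<Omega> by auto
qed

text \<open>
  Below the base letter all generators of the group for the shifted sequences are available by now;
  an element of \<open>G\<close> then carries them to \<open>x\<close>.
\<close>
lemma iota_single_Gamma:
  assumes \<Omega>: "\<Omega> \<subseteq> seqs x0" "\<Omega> \<noteq> {}" and \<gamma>: "\<gamma> \<in> Gamma x0 G (shift ` \<Omega>)"
  shows "iota [x] \<gamma> \<in> Gamma x0 G \<Omega>"
proof -
  have base: "iota [x0] ` Gamma x0 G (shift ` \<Omega>) \<subseteq> Gamma x0 G \<Omega>"
    unfolding Gamma_def[of x0 G "shift ` \<Omega>"]
    by (rule iota_generate_subset[OF Gamma_generators_AutT Gamma_subgroup])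
      (auto intro: iota_G[OF \<Omega>] iota_tilde_base[OF \<Omega>(1)])
  obtain k where k: "k \<in> G" and kx: "root_perm k x0 = x" using transitive_G by blast
  have "inv\<^bsub>AutT\<^esub> (state k x0) \<circ> \<gamma> \<circ> state k x0 \<in> Gamma x0 G (shift ` \<Omega>)"
    by (intro Gamma_comp Gamma_inv G_Gamma state_G k \<gamma>)
  then have "iota [x0] (inv\<^bsub>AutT\<^esub> (state k x0) \<circ> \<gamma> \<circ> state k x0) \<in> Gamma x0 G \<Omega>"
    using base by blast
  then show ?thesis unfolding kx[symmetric] by (rule iota_conj_Gamma[OF k])
qed

lemma shift_seqs: "\<Omega> \<subseteq> seqs x0 \<Longrightarrow> shift ` \<Omega> \<subseteq> seqs x0"
  unfolding seqs_def shift_def by blast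

lemma shift_funpow_Suc: "(shift ^^ Suc l) ` \<Omega> = (shift ^^ l) ` (shift ` \<Omega>)"
  by (simp only: funpow_Suc_right image_comp)

lemma iota_Gamma:
  assumes "\<Omega> \<subseteq> seqs x0" "\<Omega> \<noteq> {}" "\<gamma> \<in> Gamma x0 G ((shift ^^ length v) ` \<Omega>)"
  shows "iota v \<gamma> \<in> Gamma x0 G \<Omega>"
  using assms
proof (induction v arbitrary: \<Omega>)
  case Nil
  then show ?case by (simp add: iota_Nil)
next
  case (Cons x v)
  then have "iota v \<gamma> \<in> Gamma x0 G (shift ` \<Omega>)"
    unfolding list.size(4) add_Suc_right add_0_right shift_funpow_Suc
    by (intro Cons.IH) (auto intro!: shift_seqs)
  then show ?case
    using Cons.prems by (simp add: iota_Cons[of x v] iota_single_Gamma)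
qed

section \<open>Rigid stabilizers\<close>

text \<open>
  The iterated state along a word, in closed form: \<open>\<gamma>\<close> preserves lengths, so the dropped prefix is
  the image of \<open>v\<close>.
\<close>
definition section_at :: "'x list \<Rightarrow> ('x list \<Rightarrow> 'x list) \<Rightarrow> 'x list \<Rightarrow> 'x list" where
  "section_at v \<gamma> w = drop (length v) (\<gamma> (v @ w))"

lemma section_at_Gamma:
  "\<gamma> \<in> Gamma x0 G \<Omega> \<Longrightarrow> section_at v \<gamma> \<in> Gamma x0 G ((shift ^^ length v) ` \<Omega>)"
proof (induction v arbitrary: \<gamma> \<Omega>)
  case Nil
  moreover have "section_at [] \<gamma> = \<gamma>" by (simp add: section_at_def fun_eq_iff)
  ultimately show ?case by simp
next
  case (Cons x v)
  have "section_at (x # v) \<gamma> = section_at v (state \<gamma> x)"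
    using Gamma_AutT[OF Cons.prems] by (simp add: section_at_def fun_eq_iff AutT_Cons)
  then show ?case
    unfolding list.size(4) add_Suc_right add_0_right shift_funpow_Suc
    using Cons.IH state_Gamma[OF Cons.prems] by metis
qed

lemma section_at_fixed:
  assumes "\<gamma> \<in> carrier AutT" "\<gamma> v = v"
  shows "\<gamma> (v @ w) = v @ section_at v \<gamma> w"
  using AutT_append[OF assms(1), of v w] assms(2) by (auto simp: section_at_def)

lemma iota_section_RiSt:
  assumes \<Omega>: "\<Omega> \<subseteq> seqs x0" "\<Omega> \<noteq> {}" and \<gamma>: "\<gamma> \<in> Gamma x0 G ((shift ^^ length v) ` \<Omega>)"
  shows "iota v \<gamma> \<in> RiSt (Gamma x0 G \<Omega>) v"
  using iota_Gamma[OF \<Omega> \<gamma>] AutT_Nil[OF Gamma_AutT[OF \<gamma>]] by (simp add: RiSt_def iota_def)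

lemma RiSt_Gamma:
  assumes \<Omega>: "\<Omega> \<subseteq> seqs x0" "\<Omega> \<noteq> {}"
  shows "RiSt (Gamma x0 G \<Omega>) v = iota v ` Gamma x0 G ((shift ^^ length v) ` \<Omega>)"
proof
  show "RiSt (Gamma x0 G \<Omega>) v \<subseteq> iota v ` Gamma x0 G ((shift ^^ length v) ` \<Omega>)"
  proof
    fix \<gamma> assume "\<gamma> \<in> RiSt (Gamma x0 G \<Omega>) v"
    then have \<gamma>: "\<gamma> \<in> Gamma x0 G \<Omega>" and v: "\<gamma> v = v"
      and out: "\<And>u. \<not> prefix v u \<Longrightarrow> \<gamma> u = u"
      by (auto simp: RiSt_def)
    have "\<gamma> = iota v (section_at v \<gamma>)"
      using section_at_fixed[OF Gamma_AutT[OF \<gamma>] v] out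
      by (auto simp: fun_eq_iff iota_def prefix_def)
    then show "\<gamma> \<in> iota v ` Gamma x0 G ((shift ^^ length v) ` \<Omega>)"
      using section_at_Gamma[OF \<gamma>] by blast
  qed
qed (auto intro: iota_section_RiSt[OF \<Omega>])

lemma St_subgroup: "subgroup (St (Gamma x0 G \<Omega>) l) AutT"
proof (rule AutT.subgroupI)
  show "St (Gamma x0 G \<Omega>) l \<subseteq> carrier AutT" by (auto simp: St_def Gamma_AutT)
  show "St (Gamma x0 G \<Omega>) l \<noteq> {}"
  proof -
    have "id \<in> St (Gamma x0 G \<Omega>) l" by (simp add: St_def Gamma_id)
    then show ?thesis by blast
  qed
  show "inv\<^bsub>AutT\<^esub> a \<in> St (Gamma x0 G \<Omega>) l" if "a \<in> St (Gamma x0 G \<Omega>) l" for a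
    using that AutT_inv_apply(1)[OF Gamma_AutT, of a] by (auto simp: St_def Gamma_inv) metis
  show "a \<otimes>\<^bsub>AutT\<^esub> b \<in> St (Gamma x0 G \<Omega>) l"
    if "a \<in> St (Gamma x0 G \<Omega>) l" "b \<in> St (Gamma x0 G \<Omega>) l" for a b
    using that by (simp add: St_def Gamma_comp)
qed

text \<open>
  Any word of length at most \<open>l\<close> is a prefix of some word on level \<open>l\<close>, and automorphisms preserve
  prefixes.
\<close>
lemma St_fixes_shorter:
  assumes "\<gamma> \<in> St (Gamma x0 G \<Omega>) l" "length u \<le> l"
  shows "\<gamma> u = u"
proof -
  have A: "\<gamma> \<in> carrier AutT" using assms by (auto simp: St_def Gamma_AutT)
  let ?w = "replicate (l - length u) x0"
  obtain w' where "\<gamma> (u @ ?w) = \<gamma> u @ w'" using AutT_append[OF A] by blast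
  moreover have "\<gamma> (u @ ?w) = u @ ?w" using assms by (simp add: St_def)
  ultimately show ?thesis using AutT_length[OF A, of u] by (simp add: append_eq_append_conv)
qed

lemma RiSt_subset_St:
  assumes "length v = l"
  shows "RiSt (Gamma x0 G \<Omega>) v \<subseteq> St (Gamma x0 G \<Omega>) l"
proof
  fix \<gamma> assume \<gamma>: "\<gamma> \<in> RiSt (Gamma x0 G \<Omega>) v"
  have "\<gamma> u = u" if "length u = l" for u
  proof (cases "u = v")
    case False
    then have "\<not> prefix v u" using that assms by (auto simp: prefix_def)
    then show ?thesis using \<gamma> by (simp add: RiSt_def)
  qed (use \<gamma> in \<open>simp add: RiSt_def\<close>)
  then show "\<gamma> \<in> St (Gamma x0 G \<Omega>) l" using \<gamma> by (simp add: St_def RiSt_def)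
qed

text \<open>
  An element of the level stabilizer is the product of its restrictions to the subtrees of that
  level, and each restriction lies in the group, being a section embedded
  below its vertex. The induction is over the set of level vertices below which the element may
  act non-trivially.
\<close>
lemma St_subset_RiSt_level:
  assumes \<Omega>: "\<Omega> \<subseteq> seqs x0" "\<Omega> \<noteq> {}"
  shows "St (Gamma x0 G \<Omega>) l \<subseteq> RiSt_level (Gamma x0 G \<Omega>) l"
proof -
  let ?R = "RiSt_level (Gamma x0 G \<Omega>) l"
  have supp: "\<gamma> \<in> ?R"
    if "finite F" "F \<subseteq> {v. length v = l}" "\<gamma> \<in> St (Gamma x0 G \<Omega>) l"
      "\<And>u. (\<And>v. v \<in> F \<Longrightarrow> \<not> prefix v u) \<Longrightarrow> \<gamma> u = u" for F \<gamma>
    using that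
  proof (induction F arbitrary: \<gamma> rule: finite_induct)
    case empty
    then have id: "\<gamma> = id" by (simp add: fun_eq_iff)
    show ?case
      unfolding id RiSt_level_def using generate.one[of AutT] unfolding AutT_one .
  next
    case (insert v F)
    have len: "length v = l" using insert.prems by simp
    have \<gamma>: "\<gamma> \<in> Gamma x0 G \<Omega>" and v: "\<gamma> v = v" using insert.prems(2) len by (auto simp: St_def)
    define \<delta> where "\<delta> = iota v (section_at v \<gamma>)"
    have \<delta>: "\<delta> \<in> RiSt (Gamma x0 G \<Omega>) v"
      unfolding \<delta>_def by (rule iota_section_RiSt[OF \<Omega> section_at_Gamma[OF \<gamma>]])
    have \<delta>A: "\<delta> \<in> carrier AutT" using \<delta> by (auto simp: RiSt_def Gamma_AutT)
    have \<delta>St: "\<delta> \<in> St (Gamma x0 G \<Omega>) l" using \<delta> RiSt_subset_St[OF len] by blast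
    have below: "\<gamma> (v @ w) = \<delta> (v @ w)" for w
      using section_at_fixed[OF Gamma_AutT[OF \<gamma>] v] by (simp add: \<delta>_def iota_def)
    have "inv\<^bsub>AutT\<^esub> \<delta> \<circ> \<gamma> \<in> ?R"
    proof (rule insert.IH)
      show "inv\<^bsub>AutT\<^esub> \<delta> \<circ> \<gamma> \<in> St (Gamma x0 G \<Omega>) l"
        using subgroup.m_closed[OF St_subgroup subgroup.m_inv_closed[OF St_subgroup \<delta>St]
            insert.prems(2)] by simp
      fix u assume F: "\<And>v'. v' \<in> F \<Longrightarrow> \<not> prefix v' u"
      have "\<gamma> u = \<delta> u"
      proof (cases "prefix v u")
        case True
        then show ?thesis using below by (auto simp: prefix_def)
      next
        case False
        then have "\<gamma> u = u" using F by (intro insert.prems(3)) auto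
        then show ?thesis using \<delta> False by (simp add: RiSt_def)
      qed
      then show "(inv\<^bsub>AutT\<^esub> \<delta> \<circ> \<gamma>) u = u" using AutT_inv_apply(1)[OF \<delta>A] by simp
    qed (use insert.prems in auto)
    moreover have "\<delta> \<in> ?R"
      unfolding RiSt_level_def using \<delta> len by (intro generate.incl) auto
    ultimately have "\<delta> \<otimes>\<^bsub>AutT\<^esub> (inv\<^bsub>AutT\<^esub> \<delta> \<circ> \<gamma>) \<in> ?R"
      unfolding RiSt_level_def by (intro generate.eng)
    moreover have "\<delta> \<otimes>\<^bsub>AutT\<^esub> (inv\<^bsub>AutT\<^esub> \<delta> \<circ> \<gamma>) = \<gamma>"
      using AutT_inv_apply(2)[OF \<delta>A] by (simp add: fun_eq_iff)
    ultimately show ?case by simp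
  qed
  show ?thesis
  proof
    fix \<gamma> assume \<gamma>: "\<gamma> \<in> St (Gamma x0 G \<Omega>) l"
    show "\<gamma> \<in> ?R"
    proof (rule supp[of "{v. length v = l}"])
      show "finite {v :: 'x list. length v = l}"
        using finite_lists_length_eq[of "UNIV :: 'x set" l] by simp
      fix u :: "'x list" assume none: "\<And>v. v \<in> {v. length v = l} \<Longrightarrow> \<not> prefix v u"
      \<comment> \<open>a word without a prefix on the level does not reach it\<close>
      have "length u \<le> l"
        using none[of "take l u"] by (cases "length u \<le> l") (simp_all add: take_is_prefix)
      then show "\<gamma> u = u" by (rule St_fixes_shorter[OF \<gamma>])
    qed (use \<gamma> in auto)
  qed
qed

lemma RiSt_level_eq_St:
  assumes \<Omega>: "\<Omega> \<subseteq> seqs x0" "\<Omega> \<noteq> {}"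
  shows "RiSt_level (Gamma x0 G \<Omega>) l = St (Gamma x0 G \<Omega>) l"
proof
  show "RiSt_level (Gamma x0 G \<Omega>) l \<subseteq> St (Gamma x0 G \<Omega>) l"
    unfolding RiSt_level_def
    by (rule AutT.generate_subgroup_incl[OF _ St_subgroup]) (use RiSt_subset_St in blast)
qed (rule St_subset_RiSt_level[OF \<Omega>])

section \<open>Finite index and transitivity\<close>

lemma finite_image_factors:
  assumes fin: "finite (p ` A)" and fac: "\<And>a b. a \<in> A \<Longrightarrow> b \<in> A \<Longrightarrow> p a = p b \<Longrightarrow> f a = f b"
  shows "finite (f ` A)"
proof (rule finite_subset)
  show "f ` A \<subseteq> (\<lambda>y. f (inv_into A p y)) ` p ` A"
  proof (rule image_subsetI)
    fix a assume a: "a \<in> A"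
    then have "f (inv_into A p (p a)) = f a"
      by (intro fac inv_into_into f_inv_into_f imageI)
    then show "f a \<in> (\<lambda>y. f (inv_into A p y)) ` p ` A"
      using a by (metis imageI)
  qed
qed (rule finite_imageI[OF fin])

text \<open>
  A right coset of the level stabilizer is determined by the action of a representative on the
  finitely many vertices of the level.
\<close>
lemma finite_index_St:
  "finite (rcosets\<^bsub>AutT\<lparr>carrier := Gamma x0 G \<Omega>\<rparr>\<^esub> (St (Gamma x0 G \<Omega>) l))"
proof -
  let ?\<Gamma> = "Gamma x0 G \<Omega>" and ?L = "{v :: 'x list. length v = l}"
  let ?H = "St ?\<Gamma> l"
  let ?act = "\<lambda>a. restrict a ?L" and ?coset = "\<lambda>a. (\<lambda>h. h \<circ> a) ` ?H"
  have finL: "finite ?L" using finite_lists_length_eq[of "UNIV :: 'x set" l] by simp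
  have sub: "?coset a \<subseteq> ?coset b" if a: "a \<in> ?\<Gamma>" and b: "b \<in> ?\<Gamma>" and ab: "?act a = ?act b" for a b
  proof
    fix y assume "y \<in> ?coset a"
    then obtain h where h: "h \<in> ?H" and y: "y = h \<circ> a" by blast
    have bA: "b \<in> carrier AutT" using b by (rule Gamma_AutT)
    have "a \<circ> inv\<^bsub>AutT\<^esub> b \<in> ?H"
    proof -
      have "a ((inv\<^bsub>AutT\<^esub> b) v) = v" if "length v = l" for v
      proof -
        have "length ((inv\<^bsub>AutT\<^esub> b) v) = l" using that bA by (simp add: AutT_length)
        then have "a ((inv\<^bsub>AutT\<^esub> b) v) = b ((inv\<^bsub>AutT\<^esub> b) v)"
          using fun_cong[OF ab, of "(inv\<^bsub>AutT\<^esub> b) v"] by simp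
        then show ?thesis by (simp add: AutT_inv_apply(2)[OF bA])
      qed
      then show ?thesis using a b by (simp add: St_def Gamma_comp Gamma_inv)
    qed
    then have "h \<circ> (a \<circ> inv\<^bsub>AutT\<^esub> b) \<in> ?H"
      using subgroup.m_closed[OF St_subgroup h] by simp
    moreover have "y = h \<circ> (a \<circ> inv\<^bsub>AutT\<^esub> b) \<circ> b"
      by (simp add: y fun_eq_iff AutT_inv_apply(1)[OF bA])
    ultimately show "y \<in> ?coset b" by blast
  qed
  have "?act ` ?\<Gamma> \<subseteq> (\<Pi>\<^sub>E v\<in>?L. ?L)"
  proof (rule image_subsetI)
    fix a assume "a \<in> ?\<Gamma>"
    then show "?act a \<in> (\<Pi>\<^sub>E v\<in>?L. ?L)"
      by (simp only: restrict_PiE_iff) (simp add: AutT_length[OF Gamma_AutT])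
  qed
  moreover have "finite (\<Pi>\<^sub>E v\<in>?L. ?L)" by (rule finite_PiE[OF finL finL])
  ultimately have "finite (?act ` ?\<Gamma>)" by (rule finite_subset)
  then have "finite (?coset ` ?\<Gamma>)"
    by (rule finite_image_factors) (intro subset_antisym sub, simp_all only:)
  moreover have "rcosets\<^bsub>AutT\<lparr>carrier := ?\<Gamma>\<rparr>\<^esub> ?H = ?coset ` ?\<Gamma>"
    by (auto simp: RCOSETS_def r_coset_def)
  ultimately show ?thesis by simp
qed

lemma level_transitive_Gamma:
  assumes \<Omega>: "\<Omega> \<subseteq> seqs x0" "\<Omega> \<noteq> {}"
  shows "level_transitive (Gamma x0 G \<Omega>)"
proof -
  have "\<exists>\<gamma>\<in>Gamma x0 G \<Omega>. \<gamma> u = v" if "length u = length v" for u v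
    using that \<Omega>
  proof (induction u arbitrary: v \<Omega>)
    case Nil
    then show ?case using Gamma_id by (intro bexI[of _ id]) auto
  next
    case (Cons x u)
    then obtain y v' where v: "v = y # v'" and len: "length u = length v'"
      by (cases v) auto
    \<comment> \<open>an element of \<open>G\<close> corrects the first letter; what it does to the other letters is
      compensated in advance by an element acting below \<open>x\<close>\<close>
    obtain k where k: "k \<in> G" and kx: "root_perm k x = y" using transitive_G by blast
    have kA: "k \<in> carrier AutT" using k by (rule G_AutT)
    let ?s = "state k x"
    have sA: "?s \<in> carrier AutT" using kA by (rule state_in_AutT)
    obtain \<gamma> where \<gamma>: "\<gamma> \<in> Gamma x0 G (shift ` \<Omega>)" and \<gamma>u: "\<gamma> u = (inv\<^bsub>AutT\<^esub> ?s) v'"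
    proof -
      have "length u = length ((inv\<^bsub>AutT\<^esub> ?s) v')"
        using len sA by (simp add: AutT_length)
      then show ?thesis
        using Cons.IH[of "(inv\<^bsub>AutT\<^esub> ?s) v'" "shift ` \<Omega>"] Cons.prems shift_seqs that by blast
    qed
    show ?case
    proof
      show "(k \<circ> iota [x] \<gamma>) (x # u) = v"
        by (simp add: v iota_def AutT_Cons[OF kA] kx \<gamma>u AutT_inv_apply(2)[OF sA])
      show "k \<circ> iota [x] \<gamma> \<in> Gamma x0 G \<Omega>"
        using Cons.prems by (intro Gamma_comp G_Gamma k iota_single_Gamma \<gamma>)
    qed
  qed
  then show ?thesis by (simp add: level_transitive_def)
qed

end

theorem corollary3p7:
  fixes x0 :: "'x::finite"
    and G :: "('x list \<Rightarrow> 'x list) set"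
    and \<Omega> :: "(nat \<Rightarrow> 'x) set"
  assumes "subgroup G AutT"
    and "perfect G"
    and "self_similar G"
    and "property_H G"
    and "\<Omega> \<subseteq> seqs x0"
    and "\<Omega> \<noteq> {}"
  shows "(\<forall>l v. length v = l \<longrightarrow>
            RiSt (Gamma x0 G \<Omega>) v = iota v ` Gamma x0 G ((shift ^^ l) ` \<Omega>))
       \<and> (\<forall>l. RiSt_level (Gamma x0 G \<Omega>) l = St (Gamma x0 G \<Omega>) l)
       \<and> branch_group (Gamma x0 G \<Omega>)
       \<and> level_transitive (Gamma x0 G \<Omega>)"
  proof -
  interpret perfect_self_similar x0 G
    using assms(1-4) by (rule perfect_self_similar.intro)
  show ?thesis
  proof (intro conjI allI impI)
    show "branch_group (Gamma x0 G \<Omega>)"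
      unfolding branch_group_def RiSt_level_eq_St[OF assms(5,6)]
      by (intro conjI allI Gamma_subgroup finite_index_St)
    show "RiSt (Gamma x0 G \<Omega>) v = iota v ` Gamma x0 G ((shift ^^ l) ` \<Omega>)" if "length v = l" for l v
      using RiSt_Gamma[OF assms(5,6), of v] that by (simp only:)
  qed (rule RiSt_level_eq_St level_transitive_Gamma, (rule assms)+)+
qed

end
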